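(* Suppose that $\sum_{n=0}^\infty a_n^{-1}<\infty$, that $\beta_n\to\beta_\infty$ as $n\to\infty$ with $|\beta_\infty|<1$, that $\sum_n |k_n-1|<\infty$, and that $\sum_n|\beta_{n+1}-\beta_n|<\infty$. Choose some $z\in\mathbb C$. Then an arbitrary solution $F=(F_n)_{n\ge -1}$ of the Jacobi equation $$a_{n-1}F_{n-1}+b_nF_n+a_nF_{n+1}=zF_n,\qquad n\in\mathbb Z_+,$$ has the asymptotics $$F_n=a_n^{-1/2}\big(k_+e^{-i\phi_n}+k_-e^{i\phi_n}\big)\big(1+O(\varepsilon_n)\big),\qquad n\to\infty,$$ for some constants $k_\pm\in\mathbb C$. Conversely, for arbitrary $k_\pm\in\mathbb C$, there exists a solution $F$ of the Jacobi equation with this asymptotics.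
   Context: $\mathbb Z_+=\{0,1,2,\dots\}$. The coefficients satisfy $a_n>0$, $b_n\in\mathbb R$ for $n\in\mathbb Z_+$, and by convention $a_{-1}=1/2$. Notation: $$\beta_n=-\frac{b_n}{2\sqrt{a_{n-1}a_n}},\qquad \alpha_n=\frac1{2\sqrt{a_{n-1}a_n}},\qquad k_n=\frac{a_n}{\sqrt{a_{n-1}a_{n+1}}}.$$ (The constants $k_\pm$ in the claim are unrelated to the numbers $k_n$.) The phase is $\phi_n=\sum_{m}\arccos\beta_m\in\mathbb R$, the sum being over those $m\in\{0,\dots,n-1\}$ with $|\beta_m|\le1$ ($\arccos$ takes values in $[0,\pi]$). The remainder is $$\varepsilon_n=\sum_{m=n+1}^\infty\big(|\beta_{m-1}-\beta_m|+|k_m-1|+\alpha_m|z|\big).$$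
   Formalization: The common factor 1+O(ε_n) is replaced by a separate factor 1+O(ε_n) on each of the two exponentials; with one common factor the claim fails, e.g. a_n=(n+1)^2, b_n=0, z=1, k_+=k_-=1, where the bracket vanishes at every odd n. *)

theory Defs
  imports Complex_Main "HOL-Library.Landau_Symbols"
begin

text \<open>
  The sequences \<open>a\<close> and \<open>F\<close> live on the indices \<open>n \<ge> -1\<close>; they are functions on \<open>int\<close> whose
  values below \<open>-1\<close> are never used. The convention \<open>a (-1) = 1/2\<close> is an assumption of the
  theorem. Everything else is indexed by \<open>nat\<close>.
\<close>

definition alpha_coeff :: "(int \<Rightarrow> real) \<Rightarrow> nat \<Rightarrow> real" where
  "alpha_coeff a n = 1 / (2 * sqrt (a (int n - 1) * a (int n)))"

definition beta_coeff :: "(int \<Rightarrow> real) \<Rightarrow> (nat \<Rightarrow> real) \<Rightarrow> nat \<Rightarrow> real" where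
  "beta_coeff a b n = - b n / (2 * sqrt (a (int n - 1) * a (int n)))"

definition k_coeff :: "(int \<Rightarrow> real) \<Rightarrow> nat \<Rightarrow> real" where
  "k_coeff a n = a (int n) / sqrt (a (int n - 1) * a (int n + 1))"

definition phase :: "(int \<Rightarrow> real) \<Rightarrow> (nat \<Rightarrow> real) \<Rightarrow> nat \<Rightarrow> real" where
  "phase a b n = (\<Sum>m | m < n \<and> \<bar>beta_coeff a b m\<bar> \<le> 1. arccos (beta_coeff a b m))"

text \<open>The tail sum over \<open>m \<ge> n + 1\<close>, written with \<open>m = n + j + 1\<close>.\<close>

definition remainder :: "(int \<Rightarrow> real) \<Rightarrow> (nat \<Rightarrow> real) \<Rightarrow> complex \<Rightarrow> nat \<Rightarrow> real" where
  "remainder a b z n =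
     (\<Sum>j. \<bar>beta_coeff a b (n + j) - beta_coeff a b (n + j + 1)\<bar>
          + \<bar>k_coeff a (n + j + 1) - 1\<bar>
          + alpha_coeff a (n + j + 1) * cmod z)"

definition jacobi_solution ::
  "(int \<Rightarrow> real) \<Rightarrow> (nat \<Rightarrow> real) \<Rightarrow> complex \<Rightarrow> (int \<Rightarrow> complex) \<Rightarrow> bool" where
  "jacobi_solution a b z F \<longleftrightarrow>
     (\<forall>n::nat. of_real (a (int n - 1)) * F (int n - 1) + of_real (b n) * F (int n)
               + of_real (a (int n)) * F (int n + 1) = z * F (int n))"

text \<open>
  The formula \<open>F\<^sub>n = a\<^sub>n\<^bsup>-1/2\<^esup> (k\<^sub>+ e\<^bsup>-i\<phi>\<^esup> + k\<^sub>- e\<^bsup>i\<phi>\<^esup>) (1 + O(\<epsilon>\<^sub>n))\<close>, where the factor \<open>1 + O(\<epsilon>\<^sub>n)\<close> stands for a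
  factor on each of the two exponentials, with its own error \<open>r\<close> or \<open>s\<close>. A single common factor
  would force \<open>F\<^sub>n = 0\<close> whenever the two exponential terms cancel, and this fails in general: for
  \<open>b = 0\<close> and \<open>k\<^sub>+ = k\<^sub>- \<noteq> 0\<close> they cancel at every odd \<open>n\<close>, but a solution that vanishes at all
  large odd \<open>n\<close> is zero for all large \<open>n\<close> unless \<open>z = 0\<close>.
\<close>

definition has_asymptotics ::
  "(int \<Rightarrow> real) \<Rightarrow> (nat \<Rightarrow> real) \<Rightarrow> complex \<Rightarrow> complex \<Rightarrow> complex \<Rightarrow> (int \<Rightarrow> complex) \<Rightarrow> bool" where
  "has_asymptotics a b z k_plus k_minus F \<longleftrightarrow>
     (\<exists>r s :: nat \<Rightarrow> complex.
        r \<in> O(\<lambda>n. of_real (remainder a b z n)) \<and>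
        s \<in> O(\<lambda>n. of_real (remainder a b z n)) \<and>
        (\<forall>\<^sub>F n in sequentially.
           F (int n) = of_real (a (int n) powr (-1/2)) *
             (k_plus * exp (- \<i> * of_real (phase a b n)) * (1 + r n)
              + k_minus * exp (\<i> * of_real (phase a b n)) * (1 + s n))))"

end

theory Submission
  imports Defs "HOL-Analysis.Analysis"
begin

text \<open>
  Put \<open>G\<^sub>n = \<surd>a\<^sub>n F\<^sub>n\<close> and apply discrete variation of parameters: choose \<open>v\<^sub>n = (p\<^sub>n, q\<^sub>n)\<close> with
  \<open>G\<^sub>m = p\<^sub>n e\<^bsup>-i\<phi>\<^sub>m\<^esup> + q\<^sub>n e\<^bsup>i\<phi>\<^sub>m\<^esup>\<close> for \<open>m = n\<close> and \<open>m = n + 1\<close>. The Jacobi equation turns into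
  \<open>\<bar>v\<^sub>n\<^sub>+\<^sub>1 - v\<^sub>n\<bar> \<le> C \<delta>\<^sub>n \<bar>v\<^sub>n\<bar>\<close>, where \<open>\<epsilon>\<^sub>n = \<Sum>\<^sub>m\<^sub>\<ge>\<^sub>n \<delta>\<^sub>m\<close>. Hence \<open>v\<^sub>n\<close> converges to some
  \<open>(k\<^sub>+, k\<^sub>-)\<close> with error \<open>O(\<epsilon>\<^sub>n)\<close>, and the limit vanishes only if \<open>v\<^sub>n\<close> vanishes eventually, that is,
  only for \<open>F = 0\<close>. So the linear map \<open>(F\<^sub>-\<^sub>1, F\<^sub>0) \<mapsto> (k\<^sub>+, k\<^sub>-)\<close> on \<open>\<complex>\<^sup>2\<close> is injective, therefore surjective.
\<close>

section \<open>Sequences with summable relative increments\<close>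

text \<open>The increments form an absolutely convergent series, so the sequence converges by
  telescoping. Telescoping from \<open>n\<close> to infinity writes \<open>l - v n\<close> as a
  series dominated by the tail of \<open>d\<close>.\<close>

lemma summable_increments_tail:
  fixes v :: "nat \<Rightarrow> 'a::banach" and d :: "nat \<Rightarrow> real"
  assumes inc: "\<And>n. n \<ge> N \<Longrightarrow> norm (v (Suc n) - v n) \<le> M * d n"
    and d: "summable d"
  obtains l where "v \<longlonglongrightarrow> l"
    and "\<And>n. n \<ge> N \<Longrightarrow> norm (v n - l) \<le> M * (\<Sum>j. d (n + j))"
proof -
  have "summable (\<lambda>n. v (Suc n) - v n)"
    by (rule summable_comparison_test'[OF summable_mult[OF d, of M], of N]) (use inc in auto)
  then have "convergent (\<lambda>n. \<Sum>i<n. v (Suc i) - v i)"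
    by (simp add: summable_iff_convergent)
  then have "convergent (\<lambda>n. (v n - v 0) + v 0)"
    unfolding sum_lessThan_telescope by (intro convergent_add convergent_const)
  then obtain l where l: "v \<longlonglongrightarrow> l"
    by (auto simp: convergent_def)
  have "norm (v n - l) \<le> M * (\<Sum>j. d (n + j))" if n: "n \<ge> N" for n
  proof -
    have dn: "summable (\<lambda>j. M * d (n + j))"
      using summable_ignore_initial_segment[OF d, of n] by (simp add: add.commute summable_mult)
    have "(\<lambda>j. v (n + j)) \<longlonglongrightarrow> l"
      using LIMSEQ_ignore_initial_segment[OF l, of n] by (simp add: add.commute)
    then have tele: "(\<lambda>j. v (Suc (n + j)) - v (n + j)) sums (l - v n)"
      using telescope_sums[of "\<lambda>j. v (n + j)" l] by simp
    have bound: "norm (v (Suc (n + j)) - v (n + j)) \<le> M * d (n + j)" for j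
      using inc[of "n + j"] n by simp
    have "norm (l - v n) \<le> (\<Sum>j. M * d (n + j))"
      using norm_suminf_le[OF bound dn] sums_unique[OF tele] by simp
    also have "\<dots> = M * (\<Sum>j. d (n + j))"
      using summable_ignore_initial_segment[OF d, of n]
      by (intro suminf_mult) (simp add: add.commute)
    finally show ?thesis by (simp add: norm_minus_commute)
  qed
  with l that show thesis by blast
qed

text \<open>A discrete Gronwall argument: each step multiplies the norm by at most
  \<open>1 + d n\<close>, hence by at most \<open>exp (d n)\<close>, and summability of
  \<open>d\<close> keeps the product bounded. The relative bound then becomes an absolute
  one.\<close>

lemma relative_increments_tail:
  fixes v :: "nat \<Rightarrow> 'a::banach" and d :: "nat \<Rightarrow> real"
  assumes inc: "\<And>n. n \<ge> N \<Longrightarrow> norm (v (Suc n) - v n) \<le> d n * norm (v n)"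
    and d: "summable d" and d0: "\<And>n. 0 \<le> d n"
  obtains l M where "v \<longlonglongrightarrow> l"
    and "\<And>n. n \<ge> N \<Longrightarrow> norm (v n - l) \<le> M * (\<Sum>j. d (n + j))"
proof -
  have growth: "norm (v (N + j)) \<le> norm (v N) * exp (\<Sum>i<j. d (N + i))" for j
  proof (induction j)
    case (Suc j)
    have "norm (v (N + Suc j)) \<le> norm (v (N + j)) + norm (v (Suc (N + j)) - v (N + j))"
      using norm_triangle_sub[of "v (N + Suc j)" "v (N + j)"] by simp
    also have "\<dots> \<le> norm (v (N + j)) * (1 + d (N + j))"
      using inc[of "N + j"] by (simp add: algebra_simps)
    also have "\<dots> \<le> norm (v N) * exp (\<Sum>i<j. d (N + i)) * exp (d (N + j))"
      by (intro mult_mono Suc.IH exp_ge_add_one_self) (simp_all add: d0)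
    finally show ?case by (simp add: exp_add mult_ac)
  qed simp
  define M where "M = norm (v N) * exp (\<Sum>j. d (N + j))"
  have dN: "summable (\<lambda>j. d (N + j))"
    using summable_ignore_initial_segment[OF d, of N] by (simp add: add.commute)
  have bounded: "norm (v n) \<le> M" if "n \<ge> N" for n
  proof -
    have "norm (v N) * exp (\<Sum>i<n-N. d (N + i)) \<le> M"
      unfolding M_def
      by (intro mult_left_mono) (use sum_le_suminf[OF dN, of "{..<n-N}"] d0 in auto)
    then show ?thesis using growth[of "n - N"] that by simp
  qed
  have "norm (v (Suc n) - v n) \<le> M * d n" if "n \<ge> N" for n
    using inc[OF that] mult_left_mono[OF bounded[OF that] d0[of n]] by (simp add: mult.commute)
  then show thesis using summable_increments_tail[OF _ d, of N v M] that by metis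
qed

text \<open>Far out the tail of \<open>d\<close> is below 1/2. There the supremum \<open>S\<close>
  of the norms bounds all increments by \<open>S * d n\<close>, so the distance to the limit 0 is at
  most \<open>S / 2\<close>. Thus \<open>S\<close> is at most half of itself.\<close>

lemma relative_increments_zero_limit:
  fixes v :: "nat \<Rightarrow> 'a::banach" and d :: "nat \<Rightarrow> real"
  assumes inc: "\<And>n. n \<ge> N \<Longrightarrow> norm (v (Suc n) - v n) \<le> d n * norm (v n)"
    and d: "summable d" and d0: "\<And>n. 0 \<le> d n" and lim: "v \<longlonglongrightarrow> 0"
  shows "\<forall>\<^sub>F n in sequentially. v n = 0"
proof -
  have "(\<lambda>n. \<Sum>j. d (j + n)) \<longlonglongrightarrow> 0"
    using suminf_exist_split2[OF d] .
  then have "\<forall>\<^sub>F n in sequentially. (\<Sum>j. d (j + n)) < 1/2"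
    by (rule order_tendstoD) simp
  then obtain K where K: "(\<Sum>j. d (j + n)) < 1/2" if "n \<ge> K" for n
    by (auto simp: eventually_sequentially)
  define R where "R = max N K"
  obtain B where "\<And>n. norm (v n) \<le> B"
    using convergent_imp_Bseq[OF convergentI[OF lim]] by (auto simp: Bseq_def)
  then have bdd: "bdd_above ((\<lambda>n. norm (v n)) ` {R..})"
    by (intro bdd_aboveI[of _ B]) auto
  define S where "S = (SUP n\<in>{R..}. norm (v n))"
  have le_S: "norm (v n) \<le> S" if "n \<ge> R" for n
    unfolding S_def using bdd that by (intro cSUP_upper) auto
  have S0: "0 \<le> S" using le_S[of R] norm_ge_zero[of "v R"] by linarith
  have inc_S: "norm (v (Suc n) - v n) \<le> S * d n" if "n \<ge> R" for n
    using inc[of n] mult_left_mono[OF le_S[OF that] d0[of n]] that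
    by (simp add: mult.commute R_def)
  obtain l where l: "v \<longlonglongrightarrow> l" "\<And>n. n \<ge> R \<Longrightarrow> norm (v n - l) \<le> S * (\<Sum>j. d (n + j))"
    using summable_increments_tail[OF inc_S d] by blast
  have "l = 0" using LIMSEQ_unique[OF l(1) lim] .
  have half: "norm (v n) \<le> S / 2" if "n \<ge> R" for n
  proof -
    have "S * (\<Sum>j. d (n + j)) \<le> S * (1/2)"
      using K[of n] that S0 by (intro mult_left_mono) (auto simp: R_def add.commute)
    then show ?thesis using l(2)[OF that] \<open>l = 0\<close> by simp
  qed
  have "S \<le> S / 2"
    using half cSUP_least[of "{R..}" "\<lambda>n. norm (v n)" "S / 2"] by (simp add: S_def)
  then have "v n = 0" if "n \<ge> R" for n
    using le_S[OF that] S0 by simp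
  then show ?thesis by (auto simp: eventually_sequentially)
qed

section \<open>One step of the variation of parameters\<close>

text \<open>\<open>X\<close>, \<open>Y\<close> are the two exponential terms at the common node n +
  1, computed from the amplitudes of step n, and \<open>X'\<close>, \<open>Y'\<close> are those from
  step n + 1. \<open>same\<close> says that both pairs give the value at n + 1, and
  \<open>rec\<close> is the recurrence for the value at n + 2. The number \<open>s\<close> keeps the
  two characteristic roots \<open>m\<close> and \<open>cnj m\<close> apart.\<close>

lemma variation_step:
  fixes l m t X Y X' Y' :: complex and k s :: real
  assumes m: "norm m = 1" and k: "1/2 \<le> k" and s: "0 < s" "s \<le> norm (m - cnj m)"
    and same: "X' + Y' = X + Y"
    and rec: "of_real k * (X' * cnj m + Y' * m) = (m + cnj m + 2 * t) * (X + Y) - (X * l + Y * cnj l)"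
  shows "norm (X' - X) \<le> 4 / s * (norm (l - m) + \<bar>k - 1\<bar> + norm t) * (norm X + norm Y)"
    and "norm (Y' - Y) = norm (X' - X)"
proof -
  define T where "T = norm X + norm Y"
  have Y': "Y' = X + Y - X'" using same by (simp add: algebra_simps)
  show "norm (Y' - Y) = norm (X' - X)"
    unfolding Y' by (simp add: norm_minus_commute)
  \<comment> \<open>Eliminating \<open>Y'\<close> isolates the increment. Every summand on the right
    carries one of the small factors \<open>l - m\<close>, \<open>t\<close>, \<open>1 - k\<close>,
    so the increment vanishes for frozen coefficients.\<close>
  have id: "of_real k * ((X' - X) * (cnj m - m)) =
      X * (m - l) + Y * (cnj m - cnj l) + 2 * t * (X + Y) + of_real (1 - k) * (X * cnj m + Y * m)"
    using rec unfolding Y' by (simp add: algebra_simps)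
  have a: "norm (X * (m - l)) = norm X * norm (l - m)"
    "norm (Y * (cnj m - cnj l)) = norm Y * norm (l - m)"
    by (simp_all add: norm_mult norm_minus_commute flip: complex_cnj_diff)
  have b: "norm (2 * t * (X + Y)) \<le> 2 * norm t * T"
    unfolding T_def norm_mult by (intro mult_mono) (auto intro: norm_triangle_ineq)
  have "norm (X * cnj m + Y * m) \<le> T"
    unfolding T_def using norm_triangle_ineq[of "X * cnj m" "Y * m"] m by (simp add: norm_mult)
  then have c: "norm (of_real (1 - k) * (X * cnj m + Y * m)) \<le> \<bar>k - 1\<bar> * T"
    unfolding norm_mult by (intro mult_mono) (auto simp: abs_minus_commute simp del: of_real_diff)
  have "norm (of_real k * ((X' - X) * (cnj m - m))) \<le>
      norm X * norm (l - m) + norm Y * norm (l - m) + 2 * norm t * T + \<bar>k - 1\<bar> * T"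
    unfolding id using a b c by (intro norm_triangle_mono) auto
  also have "\<dots> \<le> 2 * (norm (l - m) + \<bar>k - 1\<bar> + norm t) * T"
  proof -
    have "0 \<le> norm (l - m) * T" "0 \<le> \<bar>k - 1\<bar> * T" by (simp_all add: T_def)
    then show ?thesis by (simp add: T_def algebra_simps)
  qed
  finally have up: "norm (of_real k * ((X' - X) * (cnj m - m))) \<le> \<dots>" .
  \<comment> \<open>The lower bound 1/2 for \<open>k\<close> doubles the factor 2 of the upper
    bound; this gives the 4 of the claim.\<close>
  have "1/2 * (norm (X' - X) * s) \<le> k * (norm (X' - X) * norm (m - cnj m))"
    using k s by (intro mult_mono) auto
  also have "\<dots> = norm (of_real k * ((X' - X) * (cnj m - m)))"
    using k by (simp add: norm_mult norm_minus_commute)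
  also note up
  finally show "norm (X' - X) \<le> 4 / s * (norm (l - m) + \<bar>k - 1\<bar> + norm t) * (norm X + norm Y)"
    using s by (simp add: field_simps T_def)
qed

text \<open>The real part is \<open>x\<close> itself. The imaginary part is the square root of 1 -
  x^2, whose slope is bounded only away from -1 and 1; this is where \<open>c < 1\<close>
  enters.\<close>

lemma cis_arccos_lipschitz:
  fixes x y c :: real
  assumes "\<bar>x\<bar> \<le> c" "\<bar>y\<bar> \<le> c" "c < 1"
  shows "norm (cis (arccos x) - cis (arccos y)) \<le> (1 + 1 / sqrt (1 - c\<^sup>2)) * \<bar>x - y\<bar>"
proof -
  define s where "s = sqrt (1 - c\<^sup>2)"
  have c0: "0 \<le> c" using assms by linarith
  have s: "0 < s" unfolding s_def using assms c0 by (simp add: power_less_one_iff abs_square_less_1)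
  have sx: "s \<le> sqrt (1 - x\<^sup>2)" and sy: "s \<le> sqrt (1 - y\<^sup>2)"
    unfolding s_def using assms abs_le_square_iff[of x c] abs_le_square_iff[of y c] c0 by auto
  have sq: "x\<^sup>2 \<le> 1" "y\<^sup>2 \<le> 1" using assms by (auto simp: abs_square_le_1)
  \<comment> \<open>Rationalising the difference of the roots: their sum is at least
    \<open>2 * s\<close>, and \<open>x + y\<close> is at most 2 in modulus.\<close>
  have "(sqrt (1 - x\<^sup>2) - sqrt (1 - y\<^sup>2)) * (sqrt (1 - x\<^sup>2) + sqrt (1 - y\<^sup>2)) = (y - x) * (x + y)"
    using sq by (simp add: algebra_simps power2_eq_square[symmetric])
  then have "\<bar>sqrt (1 - x\<^sup>2) - sqrt (1 - y\<^sup>2)\<bar> * \<bar>sqrt (1 - x\<^sup>2) + sqrt (1 - y\<^sup>2)\<bar> = \<bar>x - y\<bar> * \<bar>x + y\<bar>"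
    by (metis abs_minus_commute abs_mult)
  moreover have "\<bar>x - y\<bar> * \<bar>x + y\<bar> \<le> \<bar>x - y\<bar> * 2"
    using assms by (intro mult_left_mono) auto
  moreover have "\<bar>sqrt (1 - x\<^sup>2) - sqrt (1 - y\<^sup>2)\<bar> * (2 * s) \<le>
     \<bar>sqrt (1 - x\<^sup>2) - sqrt (1 - y\<^sup>2)\<bar> * \<bar>sqrt (1 - x\<^sup>2) + sqrt (1 - y\<^sup>2)\<bar>"
    using sx sy s by (intro mult_left_mono) auto
  ultimately have "\<bar>sqrt (1 - x\<^sup>2) - sqrt (1 - y\<^sup>2)\<bar> * s \<le> \<bar>x - y\<bar>" by linarith
  then have im: "\<bar>sqrt (1 - x\<^sup>2) - sqrt (1 - y\<^sup>2)\<bar> \<le> 1 / s * \<bar>x - y\<bar>"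
    using s by (simp add: field_simps)
  have "\<bar>x\<bar> \<le> 1" "\<bar>y\<bar> \<le> 1" using assms by auto
  then have "norm (cis (arccos x) - cis (arccos y)) \<le> \<bar>x - y\<bar> + \<bar>sqrt (1 - x\<^sup>2) - sqrt (1 - y\<^sup>2)\<bar>"
    using cmod_le[of "cis (arccos x) - cis (arccos y)"]
    by (simp add: cos_arccos_abs sin_arccos_abs)
  with im show ?thesis unfolding s_def[symmetric] by (simp add: algebra_simps)
qed

section \<open>Solutions of the Jacobi equation\<close>

locale jacobi_coefficients =
  fixes a :: "int \<Rightarrow> real" and b :: "nat \<Rightarrow> real" and beta_inf :: real and z :: complex
  assumes a_init: "a (-1) = 1/2"
    and a_pos_nat: "\<And>n::nat. a (int n) > 0"
    and a_summable: "summable (\<lambda>n::nat. inverse (a (int n)))"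
    and beta_lim: "beta_coeff a b \<longlonglongrightarrow> beta_inf"
    and beta_inf: "\<bar>beta_inf\<bar> < 1"
    and k_summable: "summable (\<lambda>n. \<bar>k_coeff a n - 1\<bar>)"
    and beta_summable: "summable (\<lambda>n. \<bar>beta_coeff a b (n + 1) - beta_coeff a b n\<bar>)"
begin

section \<open>The error terms and their summability\<close>

definition delta :: "nat \<Rightarrow> real" where
  "delta n = \<bar>beta_coeff a b n - beta_coeff a b (n + 1)\<bar> + \<bar>k_coeff a (n + 1) - 1\<bar>
     + alpha_coeff a (n + 1) * cmod z"

lemma remainder_eq: "remainder a b z n = (\<Sum>j. delta (n + j))"
  by (simp add: remainder_def delta_def)

lemma a_pos: "i \<ge> -1 \<Longrightarrow> a i > 0"
  using a_init a_pos_nat[of "nat i"] by (cases "i = -1") auto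

lemma alpha_nonneg: "0 \<le> alpha_coeff a n"
  using a_pos[of "int n - 1"] a_pos[of "int n"] by (simp add: alpha_coeff_def)

lemma delta_nonneg: "0 \<le> delta n"
  using alpha_nonneg[of "n + 1"] by (simp add: delta_def)

text \<open>Two of the three parts are summable by assumption. For the third,
  \<open>alpha_coeff a (n + 1)\<close> is half the geometric mean of the inverses of a_n and
  a_(n+1), so the arithmetic-geometric mean inequality bounds it by their sum.\<close>

lemma delta_summable: "summable delta"
proof -
  have amgm: "alpha_coeff a (n + 1) \<le> inverse (a (int n)) + inverse (a (int (n + 1)))" for n
  proof -
    define p q where "p = inverse (a (int n))" and "q = inverse (a (int (n + 1)))"
    have pq: "0 < p" "0 < q" by (simp_all add: p_def q_def a_pos)
    have "alpha_coeff a (n + 1) = sqrt (p * q) / 2"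
      using pq by (simp add: alpha_coeff_def p_def q_def real_sqrt_inverse real_sqrt_mult
          inverse_eq_divide real_sqrt_divide add.commute)
    also have "\<dots> \<le> p + q" using arith_geo_mean_sqrt[of p q] pq by simp
    finally show ?thesis by (simp add: p_def q_def)
  qed
  have "summable (\<lambda>n. inverse (a (int n)) + inverse (a (int (n + 1))))"
    using summable_ignore_initial_segment[OF a_summable, of 1] a_summable
    by (intro summable_add) auto
  then have "summable (\<lambda>n. alpha_coeff a (n + 1))"
    by (rule summable_comparison_test'[where N = 0])
       (use amgm alpha_nonneg in auto)
  then show ?thesis
    unfolding delta_def using beta_summable summable_ignore_initial_segment[OF k_summable, of 1]
    by (intro summable_add summable_mult2) (auto simp: abs_minus_commute)
qed

section \<open>Amplitudes and the rescaled recurrence\<close>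

abbreviation lam :: "nat \<Rightarrow> complex" where
  "lam n \<equiv> cis (arccos (beta_coeff a b n))"

abbreviation wave :: "nat \<Rightarrow> complex" where
  "wave n \<equiv> cis (phase a b n)"

definition scaled :: "(int \<Rightarrow> complex) \<Rightarrow> nat \<Rightarrow> complex" where
  "scaled F n = of_real (sqrt (a (int n))) * F (int n)"

text \<open>Cramer's rule for the pair (p, q) whose combination p e^(-i phi) + q e^(i phi) matches
  \<open>scaled F\<close> at n and n + 1. The phase at n + 1 is built into the formula through
  \<open>lam n\<close>, so the formula has this meaning only where \<open>beta_coeff a b n\<close>
  lies strictly between -1 and 1, that is, for all large n.\<close>

definition amplitudes :: "(int \<Rightarrow> complex) \<Rightarrow> nat \<Rightarrow> complex \<times> complex" where
  "amplitudes F n =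
     (wave n * (lam n * scaled F n - scaled F (Suc n)) / (lam n - cnj (lam n)),
      cnj (wave n) * (scaled F (Suc n) - cnj (lam n) * scaled F n) / (lam n - cnj (lam n)))"

text \<open>Holds at every index, since the formula is linear in \<open>F\<close> even where its
  denominator is 0. Together with the scaling rule it makes the limit of the amplitudes depend
  linearly on the solution.\<close>

lemma amplitudes_add:
  "amplitudes (\<lambda>i. F i + H i) n = amplitudes F n + amplitudes H n"
proof -
  have sc: "scaled (\<lambda>i. F i + H i) m = scaled F m + scaled H m" for m
    by (simp add: scaled_def distrib_left)
  have "w * (l * (x + x') - (y + y')) / D = w * (l * x - y) / D + w * (l * x' - y') / D"
    "w * ((y + y') - l * (x + x')) / D = w * (y - l * x) / D + w * (y' - l * x') / D"
    for w l x x' y y' D :: complex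
    by (simp_all add: add_divide_distrib diff_divide_distrib algebra_simps)
  then show ?thesis unfolding amplitudes_def sc by simp
qed

lemma amplitudes_scaleR:
  "amplitudes (\<lambda>i. c *\<^sub>R F i) n = c *\<^sub>R amplitudes F n"
proof -
  have sc: "scaled (\<lambda>i. c *\<^sub>R F i) m = c *\<^sub>R scaled F m" for m
    by (simp add: scaled_def)
  have "w * (l * (c *\<^sub>R x) - c *\<^sub>R y) / D = c *\<^sub>R (w * (l * x - y) / D)"
    "w * (c *\<^sub>R y - l * (c *\<^sub>R x)) / D = c *\<^sub>R (w * (y - l * x) / D)"
    for w l x y D :: complex
    by (simp_all add: scaleR_conv_of_real algebra_simps)
  then show ?thesis unfolding amplitudes_def sc by simp
qed

text \<open>This is the Jacobi equation at index n + 1 divided by the square root of a_n. For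
  \<open>k_coeff\<close> equal to 1 and no \<open>z\<close> term, its characteristic polynomial x^2
  - 2 beta x + 1 has the roots \<open>lam (Suc n)\<close> and its conjugate when |beta| \<le>
  1.\<close>

lemma scaled_recurrence:
  assumes "jacobi_solution a b z F"
  shows "of_real (k_coeff a (Suc n)) * scaled F (Suc (Suc n)) =
    2 * (of_real (beta_coeff a b (Suc n)) + z * of_real (alpha_coeff a (Suc n))) * scaled F (Suc n)
      - scaled F n"
proof -
  \<comment> \<open>In terms of the square roots all coefficients are rational, which leaves field
    arithmetic.\<close>
  define p q r where "p = sqrt (a (int n))" and "q = sqrt (a (int n + 1))" and "r = sqrt (a (int n + 2))"
  have pos: "0 < p" "0 < q" "0 < r" by (simp_all add: p_def q_def r_def a_pos)
  have sq: "a (int n) = p\<^sup>2" "a (int n + 1) = q\<^sup>2" "a (int n + 2) = r\<^sup>2"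
    by (simp_all add: p_def q_def r_def a_pos less_imp_le)
  have i: "int (Suc n) = int n + 1" "int n + 1 - 1 = int n" "int n + 1 + 1 = int n + 2"
    "int (Suc (Suc n)) = int n + 2" by simp_all
  have J: "of_real (p\<^sup>2) * F (int n) + of_real (b (Suc n)) * F (int n + 1) + of_real (q\<^sup>2) * F (int n + 2)
      = z * F (int n + 1)"
    using assms[unfolded jacobi_solution_def, rule_format, of "Suc n"] unfolding i sq .
  have k: "k_coeff a (Suc n) = q / p * (q / r)"
    unfolding k_coeff_def i sq real_sqrt_mult using pos by (simp add: power2_eq_square)
  have be: "beta_coeff a b (Suc n) = - b (Suc n) / (2 * (p * q))"
    unfolding beta_coeff_def i sq real_sqrt_mult using pos by simp
  have al: "alpha_coeff a (Suc n) = 1 / (2 * (p * q))"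
    unfolding alpha_coeff_def i sq real_sqrt_mult using pos by simp
  have G: "scaled F n = of_real p * F (int n)" "scaled F (Suc n) = of_real q * F (int n + 1)"
    "scaled F (Suc (Suc n)) = of_real r * F (int n + 2)"
    unfolding scaled_def i p_def q_def r_def by simp_all
  have nz: "complex_of_real p \<noteq> 0" "complex_of_real q \<noteq> 0" "complex_of_real r \<noteq> 0"
    using pos by auto
  have J': "of_real q * of_real q * F (int n + 2) =
      (z - of_real (b (Suc n))) * F (int n + 1) - of_real p * of_real p * F (int n)"
    using J unfolding power2_eq_square of_real_mult by algebra
  have "of_real p * (of_real (k_coeff a (Suc n)) * scaled F (Suc (Suc n))) = of_real q * of_real q * F (int n + 2)"
    unfolding k G using nz by (simp add: field_simps)
  also have "\<dots> = of_real p * (2 * (of_real (beta_coeff a b (Suc n)) + z * of_real (alpha_coeff a (Suc n)))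
      * scaled F (Suc n) - scaled F n)"
    unfolding J' be al G using nz by (simp add: field_simps)
  finally show ?thesis using nz by simp
qed

text \<open>Any \<open>c\<close> strictly between \<open>\<bar>beta_inf\<bar>\<close> and 1 works,
  so beta stays uniformly away from the endpoints -1 and 1, where the two roots merge.\<close>

lemma regular_tail:
  obtains N c where "c < 1" "\<And>n. n \<ge> N \<Longrightarrow> \<bar>beta_coeff a b n\<bar> \<le> c"
    "\<And>n. n \<ge> N \<Longrightarrow> 1/2 \<le> k_coeff a n"
proof -
  obtain c where c: "\<bar>beta_inf\<bar> < c" "c < 1" using dense[OF beta_inf] by blast
  have "\<forall>\<^sub>F n in sequentially. \<bar>beta_coeff a b n\<bar> < c"
    using order_tendstoD(2)[OF tendsto_rabs[OF beta_lim] c(1)] .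
  moreover have "\<forall>\<^sub>F n in sequentially. \<bar>k_coeff a n - 1\<bar> < 1/2"
    using order_tendstoD(2)[OF summable_LIMSEQ_zero[OF k_summable], of "1/2"] by simp
  ultimately have "\<forall>\<^sub>F n in sequentially. \<bar>beta_coeff a b n\<bar> \<le> c \<and> 1/2 \<le> k_coeff a n"
    by eventually_elim (auto simp: abs_if split: if_splits)
  with c that show thesis by (auto simp: eventually_sequentially)
qed

lemma wave_Suc:
  assumes "\<bar>beta_coeff a b n\<bar> \<le> 1"
  shows "wave (Suc n) = wave n * lam n"
proof -
  have "{m. m < Suc n \<and> \<bar>beta_coeff a b m\<bar> \<le> 1} = insert n {m. m < n \<and> \<bar>beta_coeff a b m\<bar> \<le> 1}"
    using assms by (auto simp: less_Suc_eq)
  then show ?thesis by (simp add: phase_def cis_mult add.commute)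
qed

text \<open>The difference is 2 i sin(arccos x). It is the denominator of the amplitudes, and the
  bound keeps it uniformly away from 0.\<close>

lemma cis_minus_cnj_arccos:
  assumes "\<bar>x\<bar> \<le> c" "c < 1"
  shows "sqrt (1 - c\<^sup>2) \<le> norm (cis (arccos x) - cnj (cis (arccos x)))"
    and "cis (arccos x) - cnj (cis (arccos x)) \<noteq> 0"
    and "0 < sqrt (1 - c\<^sup>2)"
proof -
  have "x\<^sup>2 \<le> c\<^sup>2" using assms abs_le_square_iff[of x c] by linarith
  have "c\<^sup>2 < 1" using assms by (simp add: abs_square_less_1)
  then show pos: "0 < sqrt (1 - c\<^sup>2)" by simp
  have "cis (arccos x) - cnj (cis (arccos x)) = 2 * \<i> * of_real (sqrt (1 - x\<^sup>2))"
    using assms by (auto simp: complex_eq_iff sin_arccos_abs)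
  then have n: "norm (cis (arccos x) - cnj (cis (arccos x))) = 2 * \<bar>sqrt (1 - x\<^sup>2)\<bar>"
    by (simp add: norm_mult)
  have "sqrt (1 - c\<^sup>2) \<le> sqrt (1 - x\<^sup>2)" using \<open>x\<^sup>2 \<le> c\<^sup>2\<close> by simp
  with n pos show "sqrt (1 - c\<^sup>2) \<le> norm (cis (arccos x) - cnj (cis (arccos x)))" by linarith
  with pos show "cis (arccos x) - cnj (cis (arccos x)) \<noteq> 0" by fastforce
qed

text \<open>Checks that Cramer's rule inverts the system. The strict bound makes the denominator
  nonzero and lets index n contribute to the phase, so that
  \<open>wave (Suc n) = wave n * lam n\<close>.\<close>

lemma amplitudes_spec:
  assumes "\<bar>beta_coeff a b n\<bar> < 1"
  shows "scaled F n = fst (amplitudes F n) * cnj (wave n) + snd (amplitudes F n) * wave n"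
    and "scaled F (Suc n) = fst (amplitudes F n) * cnj (wave (Suc n)) + snd (amplitudes F n) * wave (Suc n)"
proof -
  define l w D where "l = lam n" and "w = wave n" and "D = lam n - cnj (lam n)"
  have D: "D \<noteq> 0" "l - cnj l = D" unfolding D_def l_def
    using cis_minus_cnj_arccos(2)[of _ "\<bar>beta_coeff a b n\<bar>"] assms by auto
  have w: "w * cnj w = 1" "l * cnj l = 1" by (simp_all add: w_def l_def cis_cnj cis_mult)
  have W: "wave (Suc n) = w * l" using wave_Suc[of n] assms by (simp add: w_def l_def)
  have p: "fst (amplitudes F n) = w * ((l * scaled F n - scaled F (Suc n)) / D)"
    and q: "snd (amplitudes F n) = cnj w * ((scaled F (Suc n) - cnj l * scaled F n) / D)"
    by (simp_all add: amplitudes_def l_def w_def D_def)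
  have pw: "fst (amplitudes F n) * cnj w = (l * scaled F n - scaled F (Suc n)) / D"
    unfolding p using w(1) by (metis mult.assoc mult.commute mult.left_neutral)
  have qw: "snd (amplitudes F n) * w = (scaled F (Suc n) - cnj l * scaled F n) / D"
    unfolding q using w(1) by (metis mult.assoc mult.commute mult.left_neutral)
  have "fst (amplitudes F n) * cnj w + snd (amplitudes F n) * w = (l - cnj l) * scaled F n / D"
    unfolding pw qw by (simp add: algebra_simps flip: add_divide_distrib diff_divide_distrib)
  then show "scaled F n = fst (amplitudes F n) * cnj (wave n) + snd (amplitudes F n) * wave n"
    using D by (simp add: w_def)
  have "fst (amplitudes F n) * cnj (w * l) + snd (amplitudes F n) * (w * l)
      = (fst (amplitudes F n) * cnj w) * cnj l + (snd (amplitudes F n) * w) * l"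
    by (simp add: algebra_simps)
  also have "\<dots> = ((l * cnj l) * scaled F n - (l * cnj l) * scaled F n + (l - cnj l) * scaled F (Suc n)) / D"
    unfolding pw qw by (simp add: algebra_simps flip: add_divide_distrib diff_divide_distrib)
  also have "\<dots> = scaled F (Suc n)" using D by simp
  finally show "scaled F (Suc n) = fst (amplitudes F n) * cnj (wave (Suc n)) + snd (amplitudes F n) * wave (Suc n)"
    by (simp add: W)
qed

section \<open>Convergence of the amplitudes and the asymptotics\<close>

lemma amplitudes_increment:
  obtains N C where "C \<ge> 0" "\<And>n. n \<ge> N \<Longrightarrow> \<bar>beta_coeff a b n\<bar> < 1"
    "\<And>F n. jacobi_solution a b z F \<Longrightarrow> n \<ge> N \<Longrightarrow>
       norm (amplitudes F (Suc n) - amplitudes F n) \<le> C * delta n * norm (amplitudes F n)"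
proof -
  obtain N c where c: "c < 1" and be: "\<And>n. n \<ge> N \<Longrightarrow> \<bar>beta_coeff a b n\<bar> \<le> c"
    and k: "\<And>n. n \<ge> N \<Longrightarrow> 1/2 \<le> k_coeff a n"
    by (rule regular_tail) (rule that; assumption)
  define s where "s = sqrt (1 - c\<^sup>2)"
  have s: "0 < s" unfolding s_def by (rule cis_minus_cnj_arccos(3)[OF be[OF order_refl] c])
  \<comment> \<open>The Lipschitz constant of beta \<mapsto> \<open>lam\<close>. Since it is at
    least 1, it can also be put in front of the other two error terms, which gives one factor for
    all of \<open>delta n\<close>.\<close>
  define L where "L = 1 + 1 / s"
  have L: "1 \<le> L" using s by (simp add: L_def)
  have be1: "\<bar>beta_coeff a b n\<bar> < 1" if "n \<ge> N" for n
    using be[OF that] c by linarith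
  \<comment> \<open>The 16 is 4 from \<open>variation_step\<close>, times 2 for
    \<open>norm p + norm q\<close>, times 2 for the two components of the increment.\<close>
  have step: "norm (amplitudes F (Suc n) - amplitudes F n) \<le> 16 / s * L * delta n * norm (amplitudes F n)"
    if F: "jacobi_solution a b z F" and n: "n \<ge> N" for F n
  proof -
    \<comment> \<open>All phases are referred to the shared node n + 1: one step back multiplies
      \<open>w\<close> by \<open>cnj l\<close>, one step forward by \<open>m\<close>.\<close>
    define w l m where "w = wave (Suc n)" and "l = lam n" and "m = lam (Suc n)"
    define p q p' q' where "p = fst (amplitudes F n)" and "q = snd (amplitudes F n)"
      and "p' = fst (amplitudes F (Suc n))" and "q' = snd (amplitudes F (Suc n))"
    note defs = w_def l_def m_def p_def q_def p'_def q'_def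
    have unit: "norm w = 1" "norm m = 1" "norm l = 1" by (simp_all add: defs)
    have wl: "wave n = w * cnj l" using wave_Suc[of n] be1[OF n] by (simp add: defs cis_cnj cis_mult)
    have wm: "wave (Suc (Suc n)) = w * m" using wave_Suc[of "Suc n"] be1[of "Suc n"] n by (simp add: defs)
    note S = amplitudes_spec[OF be1[OF n], of F] amplitudes_spec[OF be1[of "Suc n"], of F]
    have G0: "scaled F n = (p * cnj w) * l + (q * w) * cnj l"
      using S(1) wl by (simp add: defs algebra_simps)
    have G1: "scaled F (Suc n) = p * cnj w + q * w" using S(2) by (simp add: defs)
    have G1': "scaled F (Suc n) = p' * cnj w + q' * w" using S(3) n by (simp add: defs)
    have G2: "scaled F (Suc (Suc n)) = (p' * cnj w) * cnj m + (q' * w) * m"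
      using S(4) n wm by (simp add: defs algebra_simps)
    have bm: "2 * of_real (beta_coeff a b (Suc n)) = m + cnj m"
      using be1[of "Suc n"] n by (auto simp: defs complex_eq_iff cos_arccos_abs)
    define t where "t = z * of_real (alpha_coeff a (Suc n))"
    have rec: "of_real (k_coeff a (Suc n)) * ((p' * cnj w) * cnj m + (q' * w) * m) =
        (m + cnj m + 2 * t) * (p * cnj w + q * w) - ((p * cnj w) * l + (q * w) * cnj l)"
      using scaled_recurrence[OF F, of n] unfolding G0 G1 G2 t_def bm[symmetric]
      by (simp add: algebra_simps)
    have sm: "s \<le> norm (m - cnj m)"
      unfolding s_def defs using be[of "Suc n"] n c by (intro cis_minus_cnj_arccos(1)) auto
    note V = variation_step[OF unit(2) k[of "Suc n"] s sm G1'[unfolded G1, symmetric] rec]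
    have dp: "norm (p' * cnj w - p * cnj w) = norm (p' - p)" "norm (q' * w - q * w) = norm (q' - q)"
      "norm (p * cnj w) = norm p" "norm (q * w) = norm q"
      using unit by (simp_all add: norm_mult flip: left_diff_distrib)
    have lm: "norm (l - m) \<le> L * \<bar>beta_coeff a b n - beta_coeff a b (n + 1)\<bar>"
      unfolding L_def s_def defs using cis_arccos_lipschitz[of "beta_coeff a b n" c "beta_coeff a b (Suc n)"]
        be[of n] be[of "Suc n"] n c by simp
    have rest: "\<bar>k_coeff a (Suc n) - 1\<bar> + norm t \<le> L * (\<bar>k_coeff a (Suc n) - 1\<bar> + norm t)"
      using mult_right_mono[OF L, of "\<bar>k_coeff a (Suc n) - 1\<bar> + norm t"] by simp
    have sum: "norm (l - m) + \<bar>k_coeff a (Suc n) - 1\<bar> + norm t \<le> L * delta n"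
      using lm rest alpha_nonneg[of "Suc n"] by (simp add: delta_def t_def norm_mult algebra_simps)
    have v: "norm p \<le> norm (amplitudes F n)" "norm q \<le> norm (amplitudes F n)"
      using norm_fst_le[of p q] norm_snd_le[of q p] by (simp_all add: p_def q_def)
    have "norm (p' - p) \<le> 4 / s * (norm (l - m) + \<bar>k_coeff a (Suc n) - 1\<bar> + norm t) * (norm p + norm q)"
      using V(1) n unfolding dp by simp
    also have "\<dots> \<le> 4 / s * (L * delta n) * (2 * norm (amplitudes F n))"
      using s sum v L delta_nonneg[of n] by (intro mult_mono) auto
    finally have pp: "norm (p' - p) \<le> 8 / s * L * delta n * norm (amplitudes F n)"
      by (simp add: algebra_simps)
    have "norm (q' - q) = norm (p' - p)" using V(2) n unfolding dp by simp
    moreover have "norm (amplitudes F (Suc n) - amplitudes F n) \<le> norm (p' - p) + norm (q' - q)"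
    proof -
      have "amplitudes F (Suc n) - amplitudes F n = (p' - p, q' - q)"
        by (simp add: defs prod_eq_iff)
      then show ?thesis by (simp add: norm_Pair_le)
    qed
    ultimately have "norm (amplitudes F (Suc n) - amplitudes F n)
        \<le> 2 * (8 / s * L * delta n * norm (amplitudes F n))"
      using pp by linarith
    then show ?thesis by simp
  qed
  show thesis
    by (rule that[of "16 / s * L" N]) (use step be1 s L in auto)
qed

text \<open>The limit of the amplitudes supplies the two constants, and the tail estimate is the
  error rate because the remainder is the tail sum of \<open>delta\<close>. The third conclusion
  gives the injectivity needed for the converse.\<close>

lemma amplitudes_asymptotics:
  assumes F: "jacobi_solution a b z F"
  obtains l where "amplitudes F \<longlonglongrightarrow> l" "has_asymptotics a b z (fst l) (snd l) F"
    "l = 0 \<Longrightarrow> \<forall>\<^sub>F n in sequentially. F (int n) = 0"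
proof -
  obtain N C where C: "C \<ge> 0" and be: "\<And>n. n \<ge> N \<Longrightarrow> \<bar>beta_coeff a b n\<bar> < 1"
    and inc: "\<And>n. n \<ge> N \<Longrightarrow>
       norm (amplitudes F (Suc n) - amplitudes F n) \<le> C * delta n * norm (amplitudes F n)"
    using amplitudes_increment F by metis
  have dC: "summable (\<lambda>n. C * delta n)" "\<And>n. 0 \<le> C * delta n"
    using summable_mult[OF delta_summable] C delta_nonneg by auto
  obtain l M where l: "amplitudes F \<longlonglongrightarrow> l"
    and M: "\<And>n. n \<ge> N \<Longrightarrow> norm (amplitudes F n - l) \<le> M * (\<Sum>j. C * delta (n + j))"
    using relative_increments_tail[OF inc dC] by blast
  have d: "summable (\<lambda>j. delta (n + j))" for n
    using summable_ignore_initial_segment[OF delta_summable, of n] by (simp add: add.commute)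
  have rate: "norm (amplitudes F n - l) \<le> M * C * remainder a b z n" if "n \<ge> N" for n
    using M[OF that] suminf_mult[OF d, of C n] by (simp add: remainder_eq mult.assoc)
  define p q where "p = (\<lambda>n. fst (amplitudes F n))" and "q = (\<lambda>n. snd (amplitudes F n))"
  have F_eq: "F (int n) = of_real (a (int n) powr (-1/2)) * (p n * cnj (wave n) + q n * wave n)"
    if "n \<ge> N" for n
  proof -
    have "a (int n) powr (-1/2) * sqrt (a (int n)) = 1"
      using a_pos_nat[of n] by (simp add: powr_minus powr_half_sqrt)
    then have "F (int n) = of_real (a (int n) powr (-1/2)) * scaled F n"
      by (simp add: scaled_def flip: mult.assoc of_real_mult)
    with amplitudes_spec(1)[OF be[OF that], of F] show ?thesis by (simp add: p_def q_def)
  qed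
  have zero: "\<forall>\<^sub>F n in sequentially. F (int n) = 0" if "l = 0"
  proof -
    have "\<forall>\<^sub>F n in sequentially. amplitudes F n = 0"
      by (rule relative_increments_zero_limit[where N = N, OF inc dC]) (use l that in auto)
    then show ?thesis using eventually_ge_at_top[of N]
      by eventually_elim (simp add: F_eq p_def q_def)
  qed
  have rem0: "0 \<le> remainder a b z n" for n
    unfolding remainder_eq by (intro suminf_nonneg d delta_nonneg)
  \<comment> \<open>\<open>u\<close> and \<open>u'\<close> stand for the unimodular factors left
    after dividing both errors by a single exponential, and \<open>kk\<close> for the nonzero limit
    amplitude. The summand 1 in the constant keeps it positive.\<close>
  have Oerr: "(\<lambda>n. ((p n - fst l) * u n + (q n - snd l) * u' n) / kk) \<in> O(\<lambda>n. of_real (remainder a b z n))"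
    if "\<And>n. norm (u n) = 1" "\<And>n. norm (u' n) = 1" for u u' :: "nat \<Rightarrow> complex" and kk
  proof (rule landau_o.bigI[where c = "2 * \<bar>M * C\<bar> / norm kk + 1"])
    show "0 < 2 * \<bar>M * C\<bar> / norm kk + 1" by (rule add_nonneg_pos) simp_all
    show "\<forall>\<^sub>F n in sequentially. norm (((p n - fst l) * u n + (q n - snd l) * u' n) / kk)
        \<le> (2 * \<bar>M * C\<bar> / norm kk + 1) * norm (complex_of_real (remainder a b z n))"
      using eventually_ge_at_top[of N]
    proof eventually_elim
      case (elim n)
      have r: "norm (amplitudes F n - l) \<le> \<bar>M * C\<bar> * remainder a b z n"
        using rate[OF elim] mult_right_mono[OF abs_ge_self[of "M * C"] rem0[of n]] by linarith
      have "norm ((p n - fst l) * u n + (q n - snd l) * u' n) \<le> norm (p n - fst l) + norm (q n - snd l)"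
        using norm_triangle_ineq[of "(p n - fst l) * u n" "(q n - snd l) * u' n"] that
        by (simp add: norm_mult)
      also have "\<dots> \<le> 2 * norm (amplitudes F n - l)"
        using norm_fst_le[of "p n - fst l" "q n - snd l"] norm_snd_le[of "q n - snd l" "p n - fst l"]
        by (simp add: p_def q_def flip: fst_diff snd_diff)
      also have "\<dots> \<le> 2 * \<bar>M * C\<bar> * remainder a b z n" using r by simp
      finally have "norm (((p n - fst l) * u n + (q n - snd l) * u' n) / kk)
          \<le> 2 * \<bar>M * C\<bar> * remainder a b z n / norm kk"
        by (simp add: norm_divide divide_right_mono)
      also have "\<dots> \<le> (2 * \<bar>M * C\<bar> / norm kk + 1) * norm (complex_of_real (remainder a b z n))"
        using rem0[of n] by (simp add: algebra_simps)
      finally show ?case .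
    qed
  qed
  have wv: "exp (- \<i> * of_real (phase a b n)) = cnj (wave n)" "exp (\<i> * of_real (phase a b n)) = wave n"
    "wave n * cnj (wave n) = 1" for n
    by (simp_all add: cis_cnj cis_mult flip: cis_conv_exp)
      (simp add: cis_conv_exp)
  \<comment> \<open>A nonzero limiting amplitude absorbs the errors of both exponentials.\<close>
  have "has_asymptotics a b z (fst l) (snd l) F"
  proof -
    consider "fst l \<noteq> 0" | "fst l = 0" "snd l \<noteq> 0" | "l = 0" by (auto simp: prod_eq_iff)
    then show ?thesis
    proof cases
      case 1
      \<comment> \<open>The error of the second exponential moves to the first because
        \<open>wave n\<close> is \<open>cnj (wave n)\<close> times \<open>wave n * wave n\<close>.
        The second exponential keeps error 0.\<close>
      define r where "r n = ((p n - fst l) * 1 + (q n - snd l) * (wave n * wave n)) / fst l" for n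
      have r: "p n * cnj (wave n) + q n * wave n =
          fst l * cnj (wave n) * (1 + r n) + snd l * wave n * (1 + 0)" for n
      proof -
        have "fst l * cnj (wave n) * r n = (p n - fst l) * cnj (wave n) + (q n - snd l) * wave n * (wave n * cnj (wave n))"
          using 1 by (simp add: r_def field_simps)
        also have "\<dots> = (p n - fst l) * cnj (wave n) + (q n - snd l) * wave n"
          unfolding wv(3) by simp
        finally show ?thesis by (simp add: algebra_simps)
      qed
      have "r \<in> O(\<lambda>n. of_real (remainder a b z n))"
        unfolding r_def by (rule Oerr) (simp_all add: norm_mult)
      then show ?thesis unfolding has_asymptotics_def wv
        by (intro exI[of _ r] exI[of _ "\<lambda>_. 0"] conjI eventually_mono[OF eventually_ge_at_top[of N]])
           (auto simp: F_eq r)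
    next
      case 2
      define r where "r n = ((p n - fst l) * (cnj (wave n) * cnj (wave n)) + (q n - snd l) * 1) / snd l" for n
      have r: "p n * cnj (wave n) + q n * wave n =
          fst l * cnj (wave n) * (1 + 0) + snd l * wave n * (1 + r n)" for n
      proof -
        have "snd l * wave n * r n = (p n - fst l) * cnj (wave n) * (wave n * cnj (wave n)) + (q n - snd l) * wave n"
          using 2 by (simp add: r_def field_simps)
        also have "\<dots> = (p n - fst l) * cnj (wave n) + (q n - snd l) * wave n"
          unfolding wv(3) by simp
        finally show ?thesis by (simp add: algebra_simps)
      qed
      have "r \<in> O(\<lambda>n. of_real (remainder a b z n))"
        unfolding r_def by (rule Oerr) (simp_all add: norm_mult)
      then show ?thesis unfolding has_asymptotics_def wv
        by (intro exI[of _ r] exI[of _ "\<lambda>_. 0"] conjI eventually_mono[OF eventually_ge_at_top[of N]])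
           (auto simp: F_eq r)
    next
      \<comment> \<open>With both constants 0 the formula demands that \<open>F\<close> vanish for
        all large n, which \<open>zero\<close> provides.\<close>
      case 3
      then show ?thesis unfolding has_asymptotics_def
        using zero by (intro exI[of _ "\<lambda>_. 0"]) auto
    qed
  qed
  with l zero that show thesis by blast
qed

section \<open>Initial values and the converse\<close>

text \<open>Since a_(n-1) is nonzero, the equation determines F_(n-1) from F_n and F_(n+1), so two
  adjacent zeros propagate down to the indices -1 and 0.\<close>

lemma eventually_zero_imp_zero:
  assumes F: "jacobi_solution a b z F" and "\<forall>\<^sub>F n in sequentially. F (int n) = 0"
  shows "F (-1) = 0" "F 0 = 0"
proof -
  obtain n where n: "\<And>m. m \<ge> n \<Longrightarrow> F (int m) = 0"
    using assms(2) by (auto simp: eventually_sequentially)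
  have "F (int n - 1) = 0 \<and> F (int n) = 0"
    using F[unfolded jacobi_solution_def, rule_format, of n] n[of n] n[of "Suc n"] a_pos[of "int n - 1"]
    by (auto simp: add.commute)
  then have "F (-1) = 0 \<and> F 0 = 0"
  proof (induction n)
    case (Suc n)
    then show ?case
      using F[unfolded jacobi_solution_def, rule_format, of n] a_pos[of "int n - 1"]
      by (auto simp: add.commute)
  qed simp
  then show "F (-1) = 0" "F 0 = 0" by auto
qed

text \<open>\<open>state p n\<close> is the pair (F_(n-1), F_n) for the initial data p = (F_(-1),
  F_0). Hence the value at index i is the first component at \<open>i + 1\<close>.\<close>

fun state :: "complex \<times> complex \<Rightarrow> nat \<Rightarrow> complex \<times> complex" where
  "state p 0 = p"
| "state p (Suc n) = (snd (state p n),
     ((z - of_real (b n)) * snd (state p n) - of_real (a (int n - 1)) * fst (state p n)) / of_real (a (int n)))"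

definition solution :: "complex \<times> complex \<Rightarrow> int \<Rightarrow> complex" where
  "solution p i = fst (state p (nat (i + 1)))"

lemma solution_jacobi: "jacobi_solution a b z (solution p)"
  unfolding jacobi_solution_def
proof
  fix n :: nat
  have "nat (int n + 1) = Suc n" "nat (int n + 1 + 1) = Suc (Suc n)" "nat (int n - 1 + 1) = n" by auto
  then show "of_real (a (int n - 1)) * solution p (int n - 1) + of_real (b n) * solution p (int n)
      + of_real (a (int n)) * solution p (int n + 1) = z * solution p (int n)"
    using a_pos_nat[of n] by (simp add: solution_def field_simps)
qed

lemma solution_initial: "solution p (-1) = fst p" "solution p 0 = snd p"
  by (simp_all add: solution_def)

lemma solution_add: "solution (p + q) i = solution p i + solution q i"
proof -
  have "state (p + q) n = state p n + state q n" for n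
    by (induction n) (simp_all add: algebra_simps add_divide_distrib diff_divide_distrib)
  then show ?thesis by (simp add: solution_def)
qed

lemma solution_scaleR: "solution (c *\<^sub>R p) i = c *\<^sub>R solution p i"
proof -
  have "state (c *\<^sub>R p) n = c *\<^sub>R state p n" for n
    by (induction n) (simp_all add: scaleR_conv_of_real algebra_simps)
  then show ?thesis by (simp add: solution_def)
qed

text \<open>As a pointwise limit of real-linear maps \<open>K\<close> is linear. Its kernel is
  trivial, because a solution that vanishes eventually has zero initial data. An injective linear
  map of a finite-dimensional space to itself is onto.\<close>

lemma limit_amplitudes_surj:
  assumes K: "\<And>p. amplitudes (solution p) \<longlonglongrightarrow> K p"
    and K0: "\<And>p. K p = 0 \<Longrightarrow> \<forall>\<^sub>F n in sequentially. solution p (int n) = 0"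
  shows "surj K"
proof -
  have lin: "linear K"
  proof (rule linearI)
    fix p q
    have "solution (p + q) = (\<lambda>i. solution p i + solution q i)" by (simp add: fun_eq_iff solution_add)
    then have "amplitudes (solution (p + q)) \<longlonglongrightarrow> K p + K q"
      using tendsto_add[OF K[of p] K[of q]] by (simp add: amplitudes_add[abs_def])
    then show "K (p + q) = K p + K q" using K LIMSEQ_unique by blast
  next
    fix c p
    have "solution (c *\<^sub>R p) = (\<lambda>i. c *\<^sub>R solution p i)" by (simp add: fun_eq_iff solution_scaleR)
    then have "amplitudes (solution (c *\<^sub>R p)) \<longlonglongrightarrow> c *\<^sub>R K p"
      using tendsto_scaleR[OF tendsto_const K[of p]] by (simp add: amplitudes_scaleR[abs_def])
    then show "K (c *\<^sub>R p) = c *\<^sub>R K p" using K LIMSEQ_unique by blast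
  qed
  have "p = 0" if "K p = 0" for p
    using eventually_zero_imp_zero[OF solution_jacobi K0[OF that]]
    by (simp add: solution_initial prod_eq_iff)
  then have "inj K" using lin by (auto simp: linear_injective_0)
  then show "surj K" by (rule linear_inj_imp_surj[OF lin])
qed

lemma exists_solution:
  "\<exists>F. jacobi_solution a b z F \<and> has_asymptotics a b z k_plus k_minus F"
proof -
  have "\<exists>l. amplitudes (solution p) \<longlonglongrightarrow> l \<and> has_asymptotics a b z (fst l) (snd l) (solution p) \<and>
      (l = 0 \<longrightarrow> (\<forall>\<^sub>F n in sequentially. solution p (int n) = 0))" for p
    by (rule amplitudes_asymptotics[OF solution_jacobi[of p]]) blast
  \<comment> \<open>\<open>K\<close> sends the initial data to the limit amplitudes, so a preimage
    of \<open>(k_plus, k_minus)\<close> yields the solution sought.\<close>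
  then obtain K where K: "\<And>p. amplitudes (solution p) \<longlonglongrightarrow> K p"
    "\<And>p. has_asymptotics a b z (fst (K p)) (snd (K p)) (solution p)"
    "\<And>p. K p = 0 \<Longrightarrow> \<forall>\<^sub>F n in sequentially. solution p (int n) = 0"
    by metis
  have "surj K" using K(1,3) by (rule limit_amplitudes_surj)
  then obtain p where "K p = (k_plus, k_minus)" by (metis surjD)
  then show ?thesis using K(2)[of p] solution_jacobi[of p] by auto
qed

end

theorem theorem4p1:
  fixes a :: "int \<Rightarrow> real" and b :: "nat \<Rightarrow> real" and beta_inf :: real and z :: complex
  assumes "a (-1) = 1/2"
    and "\<And>n::nat. a (int n) > 0"
    and "summable (\<lambda>n::nat. inverse (a (int n)))"
    and "beta_coeff a b \<longlonglongrightarrow> beta_inf"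
    and "\<bar>beta_inf\<bar> < 1"
    and "summable (\<lambda>n. \<bar>k_coeff a n - 1\<bar>)"
    and "summable (\<lambda>n. \<bar>beta_coeff a b (n + 1) - beta_coeff a b n\<bar>)"
  shows "(\<forall>F. jacobi_solution a b z F \<longrightarrow>
             (\<exists>k_plus k_minus. has_asymptotics a b z k_plus k_minus F))
       \<and> (\<forall>k_plus k_minus. \<exists>F. jacobi_solution a b z F \<and> has_asymptotics a b z k_plus k_minus F)"
proof -
  interpret jacobi_coefficients a b beta_inf z
    by unfold_locales (fact assms)+
  show ?thesis
    using exists_solution amplitudes_asymptotics by metis
qed

end
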